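(* Let $d\ge 1$. Every polynomial $T_{10^a10^b10^c}=\operatorname{Tr}\big(A_1A_0^aA_1A_0^bA_1A_0^c\big)$, with integers $1<a\le b\le c$ and $a+b+c=d-3$, is an element of the $\mathbb{C}$-linear span $\langle T_{\beta} : \beta\in\tilde{B}_3\rangle$.
   Context: Let $A_0=\begin{pmatrix} a_1 & a_2 \\ a_3 & a_4\end{pmatrix}$ and $A_1=\begin{pmatrix} b_1 & b_2 \\ b_3 & b_4\end{pmatrix}$ be generic $2\times 2$ matrices whose entries are the eight variables of the polynomial ring $\mathbb{C}[a_1,\dots,a_4,b_1,\dots,b_4]$. For a binary word $i_1\cdots i_d$ with $i_j\in\{0,1\}$, put $T_{i_1\cdots i_d}:=\operatorname{Tr}(A_{i_1}\cdots A_{i_d})\in\mathbb{C}[a_1,\dots,b_4]$; in a word, $0^a$ denotes $a$ consecutive zeros. A binary bracelet of length $d$ is an equivalence class of words in $\{0,1\}^d$ under the dihedral group generated by cyclic rotation and reversal of words. For $2\times2$ matrices $T_{i_1\cdots i_d}$ is invariant under rotation and reversal of the word, so $T_\beta$ is well defined for a bracelet $\beta$. $B_3(2,d)$ denotes the set of binary bracelets of length $d$ of weight $3$, meaning that they contain exactly three letters equal to $1$. The subset $\tilde{B}_3\subset B_3(2,d)$ is $$\tilde{B}_3:=\{\beta\in B_3(2,d) : \beta \text{ contains } 11 \text{ or } 101\},$$ where "$\beta$ contains $u$" means that some word representing $\beta$ contains $u$ as a string of consecutive letters. *)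

theory Defs
  imports
    "HOL-Analysis.Analysis"
    "HOL-Library.Poly_Mapping"
    "HOL-Library.Sublist"
    "HOL-Library.Z2"
begin

datatype indet = a1 | a2 | a3 | a4 | b1 | b2 | b3 | b4

text \<open>
  The polynomial ring \<open>\<complex>[a1, \<dots>, a4, b1, \<dots>, b4]\<close>: finitely supported coefficient functions
  on the exponent vectors, multiplied by convolution.
\<close>

type_synonym poly8 = "(indet \<Rightarrow>\<^sub>0 nat) \<Rightarrow>\<^sub>0 complex"

definition Var :: "indet \<Rightarrow> poly8" where
  "Var x = Poly_Mapping.single (Poly_Mapping.single x 1) 1"

definition Const :: "complex \<Rightarrow> poly8" where
  "Const c = Poly_Mapping.single 0 c"

definition mat2 :: "'r::zero \<Rightarrow> 'r \<Rightarrow> 'r \<Rightarrow> 'r \<Rightarrow> 'r ^ 2 ^ 2" where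
  "mat2 p q r s = vector [vector [p, q], vector [r, s]]"

fun gen_mat :: "bit \<Rightarrow> poly8 ^ 2 ^ 2" where
  "gen_mat 0 = mat2 (Var a1) (Var a2) (Var a3) (Var a4)"
| "gen_mat 1 = mat2 (Var b1) (Var b2) (Var b3) (Var b4)"

definition word_mat :: "bit list \<Rightarrow> poly8 ^ 2 ^ 2" where
  "word_mat w = foldr (\<lambda>i M. gen_mat i ** M) w (mat 1)"

definition T_word :: "bit list \<Rightarrow> poly8" where
  "T_word w = trace (word_mat w)"

definition dihedral_rel :: "(bit list \<times> bit list) set" where
  "dihedral_rel = {(v, w). \<exists>k. w = rotate k v \<or> w = rotate k (rev v)}"

definition bracelets :: "nat \<Rightarrow> bit list set set" where
  "bracelets d = {w. length w = d} // dihedral_rel"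

definition B3 :: "nat \<Rightarrow> bit list set set" where
  "B3 d = {\<beta> \<in> bracelets d. \<forall>w\<in>\<beta>. count_list w 1 = 3}"

definition contains_word :: "bit list set \<Rightarrow> bit list \<Rightarrow> bool" where
  "contains_word \<beta> u \<longleftrightarrow> (\<exists>w\<in>\<beta>. sublist u w)"

definition B3_tilde :: "nat \<Rightarrow> bit list set set" where
  "B3_tilde d = {\<beta> \<in> B3 d. contains_word \<beta> [1, 1] \<or> contains_word \<beta> [1, 0, 1]}"

text \<open>
  The common value of \<^const>\<open>T_word\<close> on the words of a bracelet; \<open>T_bracelet_eq\<close> below shows
  that it is well defined.
\<close>

definition T_bracelet :: "bit list set \<Rightarrow> poly8" where
  "T_bracelet \<beta> = the_elem (T_word ` \<beta>)"

definition complex_span :: "poly8 set \<Rightarrow> poly8 set" where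
  "complex_span = module.span (\<lambda>c p. Const c * p)"

lemma vector_space_poly8: "vector_space (\<lambda>c p. Const c * p)"
proof
  fix a b :: complex and x y :: poly8
  show "Const a * (x + y) = Const a * x + Const a * y"
    by (rule distrib_left)
  show "Const (a + b) * x = Const a * x + Const b * x"
    by (simp add: Const_def single_add distrib_right)
  show "Const a * (Const b * x) = Const (a * b) * x"
    by (simp add: Const_def mult_single mult.assoc[symmetric])
  show "Const 1 * x = x"
    by (simp add: Const_def)
qed

lemma equiv_dihedral_rel: "equiv UNIV dihedral_rel"
proof (rule equivI)
  show "refl dihedral_rel"
    by (auto simp: refl_on_def dihedral_rel_def intro: exI[of _ 0])
  have inv: "\<exists>m. rotate m (rotate k v) = v" for k and v :: "bit list"
  proof -
    have "rotate (length v * k - k) (rotate k v) = v" if "v \<noteq> []"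
    proof -
      have "k \<le> length v * k" using that by (cases v) auto
      then show ?thesis by (simp add: rotate_rotate)
    qed
    then show ?thesis by (cases "v = []") auto
  qed
  have rev_rot: "\<exists>m. rev (rotate k v) = rotate m (rev v)" for k and v :: "bit list"
  proof -
    show ?thesis
    proof (cases "v = []")
      case False
      have "rotate (length v - k mod length v) (rev v) =
          rev (rotate (length v - (length v - k mod length v) mod length v) v)"
        by (simp add: rotate_rev)
      also have "\<dots> = rev (rotate k v)"
      proof (cases "k mod length v = 0")
        case False
        then have "length v - (length v - k mod length v) mod length v = k mod length v"
          using \<open>v \<noteq> []\<close> by (simp add: less_imp_le)
        then show ?thesis by (metis rotate_conv_mod)
      qed simp
      finally show ?thesis by metis
    qed auto
  qed
  show "sym dihedral_rel"
  proof (rule symI)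
    fix v w assume "(v, w) \<in> dihedral_rel"
    then obtain k where "w = rotate k v \<or> w = rotate k (rev v)"
      by (auto simp: dihedral_rel_def)
    then show "(w, v) \<in> dihedral_rel"
    proof
      assume "w = rotate k v"
      then show ?thesis using inv[of k v] by (auto simp: dihedral_rel_def) metis
    next
      assume w: "w = rotate k (rev v)"
      obtain m where m: "rev (rotate k (rev v)) = rotate m v" using rev_rot[of k "rev v"] by auto
      obtain n where "rotate n (rotate m v) = v" using inv by blast
      then have "v = rotate n (rev w)" using w m by simp
      then show ?thesis by (auto simp: dihedral_rel_def)
    qed
  qed
  show "trans dihedral_rel"
  proof (rule transI)
    fix u v w assume uv: "(u, v) \<in> dihedral_rel" and vw: "(v, w) \<in> dihedral_rel"
    obtain k where k: "v = rotate k u \<or> v = rotate k (rev u)"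
      using uv by (auto simp: dihedral_rel_def)
    obtain l where l: "w = rotate l v \<or> w = rotate l (rev v)"
      using vw by (auto simp: dihedral_rel_def)
    have "\<exists>m. rev v = rotate m u \<or> rev v = rotate m (rev u)"
      using k rev_rot[of k u] rev_rot[of k "rev u"] by auto
    then obtain m where m: "rev v = rotate m u \<or> rev v = rotate m (rev u)" by blast
    show "(u, w) \<in> dihedral_rel"
      using k l m by (auto simp: dihedral_rel_def rotate_rotate)
  qed
qed simp

lemma word_mat_Nil [simp]: "word_mat [] = mat 1"
  and word_mat_Cons [simp]: "word_mat (i # w) = gen_mat i ** word_mat w"
  by (simp_all add: word_mat_def)

lemma word_mat_append: "word_mat (v @ w) = word_mat v ** word_mat w"
  by (induction v) (simp_all add: matrix_mul_assoc)

lemma T_word_rotate: "T_word (rotate k w) = T_word w"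
proof (induction k)
  case (Suc k)
  have "T_word (rotate1 v) = T_word v" for v
  proof (cases v)
    case (Cons i u)
    then have "T_word (rotate1 v) = trace (word_mat u ** gen_mat i)"
      by (simp add: T_word_def word_mat_append)
    also have "\<dots> = trace (gen_mat i ** word_mat u)"
      by (rule trace_mul_sym)
    finally show ?thesis
      using Cons by (simp add: T_word_def)
  qed simp
  with Suc show ?case by simp
qed simp

text \<open>
  Reversal invariance: modulo the Cayley-Hamilton identities, the matrix of a word is
  \<open>p + q A\<^sub>0 + r A\<^sub>1 + s A\<^sub>0 A\<^sub>1\<close>, and that of the reversed word is
  \<open>p + q A\<^sub>0 + r A\<^sub>1 + s A\<^sub>1 A\<^sub>0\<close> with the same coefficients.
\<close>

definition rev_pair :: "'r::comm_ring_1 ^ 2 ^ 2 \<Rightarrow> 'r ^ 2 ^ 2 \<Rightarrow> 'r ^ 2 ^ 2 \<Rightarrow> 'r ^ 2 ^ 2 \<Rightarrow> bool" where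
  "rev_pair X Y M N \<longleftrightarrow> (\<exists>p q r s. \<forall>i j.
     M $ i $ j = p * mat 1 $ i $ j + q * X $ i $ j + r * Y $ i $ j + s * (X ** Y) $ i $ j \<and>
     N $ i $ j = p * mat 1 $ i $ j + q * X $ i $ j + r * Y $ i $ j + s * (Y ** X) $ i $ j)"

lemma rev_pair_step:
  fixes X Y :: "'r::comm_ring_1 ^ 2 ^ 2"
  assumes "rev_pair X Y M N"
  shows "rev_pair X Y (X ** M) (N ** X)" and "rev_pair X Y (Y ** M) (N ** Y)"
proof -
  obtain p q r s where MN: "\<And>i j.
     M $ i $ j = p * mat 1 $ i $ j + q * X $ i $ j + r * Y $ i $ j + s * (X ** Y) $ i $ j"
     "\<And>i j. N $ i $ j = p * mat 1 $ i $ j + q * X $ i $ j + r * Y $ i $ j + s * (Y ** X) $ i $ j"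
    using assms unfolding rev_pair_def by blast
  obtain x1 x2 x3 x4 where x: "X $ 1 $ 1 = x1" "X $ 1 $ 2 = x2" "X $ 2 $ 1 = x3" "X $ 2 $ 2 = x4"
    by blast
  obtain y1 y2 y3 y4 where y: "Y $ 1 $ 1 = y1" "Y $ 1 $ 2 = y2" "Y $ 2 $ 1 = y3" "Y $ 2 $ 2 = y4"
    by blast
  let ?dx = "x1 * x4 - x2 * x3" and ?dy = "y1 * y4 - y2 * y3"
  let ?txy = "x1 * y1 + x2 * y3 + x3 * y2 + x4 * y4"
  have I: "(mat 1 :: 'r ^ 2 ^ 2) $ 1 $ 1 = 1" "(mat 1 :: 'r ^ 2 ^ 2) $ 1 $ 2 = 0"
    "(mat 1 :: 'r ^ 2 ^ 2) $ 2 $ 1 = 0" "(mat 1 :: 'r ^ 2 ^ 2) $ 2 $ 2 = 1"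
    by (simp_all add: mat_def)
  have mult: "(A ** B) $ i $ j = A $ i $ 1 * B $ 1 $ j + A $ i $ 2 * B $ 2 $ j"
    for A B :: "'r ^ 2 ^ 2" and i j
    by (simp add: matrix_matrix_mult_def sum_2)
  note entries = forall_2 mult MN I x y
  show "rev_pair X Y (X ** M) (N ** X)"
    unfolding rev_pair_def
    by (rule exI[of _ "- q * ?dx"], rule exI[of _ "p + q * (x1 + x4)"],
        rule exI[of _ "- s * ?dx"], rule exI[of _ "r + s * (x1 + x4)"])
      (simp only: entries, intro conjI; simp add: algebra_simps)
  show "rev_pair X Y (Y ** M) (N ** Y)"
    unfolding rev_pair_def
    by (rule exI[of _ "q * (?txy - (x1 + x4) * (y1 + y4)) - r * ?dy - s * ?dy * (x1 + x4)"],
        rule exI[of _ "q * (y1 + y4) + s * ?dy"],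
        rule exI[of _ "p + q * (x1 + x4) + r * (y1 + y4) + s * ?txy"],
        rule exI[of _ "- q"])
      (simp only: entries, intro conjI; simp add: algebra_simps)
qed

lemma rev_pair_trace:
  assumes "rev_pair X Y M N"
  shows "trace N = trace M"
  using assms
  by (auto simp: rev_pair_def trace_def sum_2 matrix_matrix_mult_def algebra_simps)

lemma T_word_rev: "T_word (rev w) = T_word w"
proof -
  have "rev_pair (gen_mat 0) (gen_mat 1) (word_mat w) (word_mat (rev w))"
  proof (induction w)
    case Nil
    show ?case unfolding rev_pair_def
      by (rule exI[of _ 1], rule exI[of _ 0], rule exI[of _ 0], rule exI[of _ 0]) simp
  next
    case (Cons i w)
    have "word_mat (rev (i # w)) = word_mat (rev w) ** gen_mat i"
      by (simp add: word_mat_append)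
    then show ?case
      using rev_pair_step[OF Cons] by (cases "i = 0") (simp_all del: gen_mat.simps)
  qed
  then show ?thesis
    unfolding T_word_def by (rule rev_pair_trace)
qed

lemma T_bracelet_eq:
  assumes "\<beta> \<in> bracelets d" "w \<in> \<beta>"
  shows "T_bracelet \<beta> = T_word w"
proof -
  obtain v where "\<beta> = dihedral_rel `` {v}"
    using assms(1) by (auto simp: bracelets_def quotient_def)
  then have "T_word u = T_word v" if "u \<in> \<beta>" for u
    using that by (auto simp: dihedral_rel_def T_word_rotate T_word_rev)
  then have "T_word ` \<beta> = {T_word w}"
    using assms(2) by fastforce
  then show ?thesis by (simp add: T_bracelet_def)
qed

end

theory Submission
  imports Defs
begin

text \<open>
  Write \<open>t a b c\<close> for the trace in question and \<open>n = a + b + c\<close>. If \<open>A\<^sub>0\<close> is diagonal, expanding the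
  trace gives \<open>t a b c = g a + g b + g c\<close> for a function \<open>g\<close> depending on \<open>n\<close>. In such a sum,
  replacing \<open>(a + 1, b)\<close> by \<open>(a, b + 1)\<close> changes the value by a difference of two increments of \<open>g\<close>,
  and every increment \<open>g (i + 1) - g i - (g 1 - g 0)\<close> equals
  \<open>t 0 (i + 1) (n - i - 1) - t 1 i (n - i - 1)\<close>, which lies in the span. Lowering \<open>a\<close> to \<open>0\<close> in this
  way proves the claim. The resulting exchange identity is verified for arbitrary \<open>A\<^sub>0\<close>: by
  Cayley-Hamilton the powers of \<open>A\<^sub>0\<close> are combinations of \<open>1\<close> and \<open>A\<^sub>0\<close>, and \<open>t\<close> is a symmetric
  trilinear form in their coordinates.
\<close>

text \<open>A relation, as the coordinates need not be unique, for instance when \<open>A\<close> is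
  scalar.\<close>

definition coords_in :: "'r::comm_ring_1 ^ 2 ^ 2 \<Rightarrow> 'r \<Rightarrow> 'r \<Rightarrow> 'r ^ 2 ^ 2 \<Rightarrow> bool" where
  "coords_in A p q X \<longleftrightarrow> (\<forall>i j. X $ i $ j = p * mat 1 $ i $ j + q * A $ i $ j)"

lemma mat2_mult_entry:
  fixes A B :: "'r::comm_ring_1 ^ 2 ^ 2"
  shows "(A ** B) $ i $ j = A $ i $ 1 * B $ 1 $ j + A $ i $ 2 * B $ 2 $ j"
  by (simp add: matrix_matrix_mult_def sum_2)

lemma coords_in_one: "coords_in A 1 0 (mat 1)"
  and coords_in_self: "coords_in A 0 1 A"
  by (simp_all add: coords_in_def)

text \<open>Cayley-Hamilton: \<open>A ** A\<close> is the trace times \<open>A\<close> minus the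
  determinant times \<open>mat 1\<close>.\<close>

lemma coords_in_mult:
  assumes "coords_in A p q X" "coords_in A r s Y"
  shows "coords_in A (p * r - q * s * (A $ 1 $ 1 * A $ 2 $ 2 - A $ 1 $ 2 * A $ 2 $ 1))
    (p * s + q * r + q * s * (A $ 1 $ 1 + A $ 2 $ 2)) (X ** Y)"
  using assms
  by (simp add: coords_in_def forall_2 mat2_mult_entry mat_def algebra_simps)

text \<open>Cyclic invariance of the trace merges the three placements of a lone \<open>B\<close> or
  \<open>C\<close>.\<close>

lemma trace_mult3_comb:
  fixes B C M1 M2 M3 :: "'r::comm_ring_1 ^ 2 ^ 2"
  assumes "\<And>i j. M1 $ i $ j = p * B $ i $ j + q * C $ i $ j"
    and "\<And>i j. M2 $ i $ j = r * B $ i $ j + s * C $ i $ j"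
    and "\<And>i j. M3 $ i $ j = u * B $ i $ j + v * C $ i $ j"
  shows "trace (M1 ** M2 ** M3) = p * r * u * trace (B ** B ** B)
    + (p * r * v + p * s * u + q * r * u) * trace (B ** B ** C)
    + (p * s * v + q * r * v + q * s * u) * trace (B ** C ** C)
    + q * s * v * trace (C ** C ** C)"
  by (simp add: trace_def sum_2 mat2_mult_entry assms algebra_simps)

lemma trace_coords_in:
  assumes "coords_in A p q X" "coords_in A r s Y" "coords_in A u v Z"
  shows "trace ((B ** X) ** (B ** Y) ** (B ** Z)) = p * r * u * trace (B ** B ** B)
    + (p * r * v + p * s * u + q * r * u) * trace (B ** B ** (B ** A))
    + (p * s * v + q * r * v + q * s * u) * trace (B ** (B ** A) ** (B ** A))
    + q * s * v * trace ((B ** A) ** (B ** A) ** (B ** A))"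
proof -
  \<comment> \<open>\<open>B ** A\<close> serves as \<open>C\<close> in
    \<open>trace_mult3_comb\<close>.\<close>
  have "(B ** W) $ i $ j = x * B $ i $ j + y * (B ** A) $ i $ j" if "coords_in A x y W" for x y W i j
    using that exhaust_2[of j]
    by (auto simp: coords_in_def mat2_mult_entry mat_def algebra_simps)
  then show ?thesis using assms by (intro trace_mult3_comb) auto
qed

lemma trace_exchange:
  fixes A B X Y Z :: "'r::comm_ring_1 ^ 2 ^ 2"
  assumes "coords_in A p q X" "coords_in A r s Y" "coords_in A u v Z"
  defines "t \<equiv> \<lambda>U V W. trace ((B ** U) ** (B ** V) ** (B ** W))"
  shows "t (A ** X) Y Z = t X (A ** Y) Z
    + (t (mat 1) (A ** X) (Y ** Z) - t A X (Y ** Z))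
    - (t (mat 1) (A ** Y) (X ** Z) - t A Y (X ** Z))"
proof -
  note one = coords_in_one[of A] and self = coords_in_self[of A]
  note AX = coords_in_mult[OF self assms(1)] and AY = coords_in_mult[OF self assms(2)]
  note XZ = coords_in_mult[OF assms(1,3)] and YZ = coords_in_mult[OF assms(2,3)]
  \<comment> \<open>Expansion leaves a polynomial identity in the coordinates, the entries of
    \<open>A\<close> and the four traces.\<close>
  show ?thesis
    unfolding t_def trace_coords_in[OF AX assms(2,3)] trace_coords_in[OF assms(1) AY assms(3)]
      trace_coords_in[OF one AX YZ] trace_coords_in[OF self assms(1) YZ]
      trace_coords_in[OF one AY XZ] trace_coords_in[OF self assms(2) XZ]
    by (simp only: mult_zero_left mult_zero_right mult_1_left mult_1_right add_0_left add_0_right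
        diff_0 diff_zero) (simp add: algebra_simps)
qed

lemma coords_in_word_mat_zeros: "\<exists>p q. coords_in (gen_mat 0) p q (word_mat (replicate n 0))"
proof (induction n)
  case 0
  show ?case using coords_in_one by auto
next
  case (Suc n)
  then show ?case using coords_in_mult[OF coords_in_self] by (fastforce simp del: gen_mat.simps)
qed

definition T3 :: "nat \<Rightarrow> nat \<Rightarrow> nat \<Rightarrow> poly8" where
  "T3 a b c = T_word ([1] @ replicate a 0 @ [1] @ replicate b 0 @ [1] @ replicate c 0)"

lemma T3_exchange:
  "T3 (Suc a) b c = T3 a (Suc b) c + (T3 0 (Suc a) (b + c) - T3 1 a (b + c))
    - (T3 0 (Suc b) (a + c) - T3 1 b (a + c))"
proof -
  obtain p q r s u v where coords:
    "coords_in (gen_mat 0) p q (word_mat (replicate a 0))"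
    "coords_in (gen_mat 0) r s (word_mat (replicate b 0))"
    "coords_in (gen_mat 0) u v (word_mat (replicate c 0))"
    using coords_in_word_mat_zeros by meson
  show ?thesis
    using trace_exchange[OF coords, of "gen_mat 1"]
    by (simp add: T3_def T_word_def word_mat_append replicate_add matrix_mul_assoc del: gen_mat.simps)
qed

lemma count_list_rotate: "count_list (rotate k xs) x = count_list xs x"
proof (induction k)
  case (Suc k)
  have "count_list (rotate1 ys) x = count_list ys x" for ys
    by (cases ys) auto
  with Suc show ?case by simp
qed simp

lemma T_word_in_span:
  assumes "length w = d" "count_list w 1 = 3" "sublist [1, 1] w \<or> sublist [1, 0, 1] w"
  shows "T_word w \<in> complex_span (T_bracelet ` B3_tilde d)"
proof -
  interpret vector_space "\<lambda>c p. Const c * p" by (rule vector_space_poly8)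
  define \<beta> where "\<beta> = dihedral_rel `` {w}"
  have \<beta>: "\<beta> \<in> bracelets d"
    using assms(1) by (auto simp: \<beta>_def bracelets_def intro: quotientI)
  have w: "w \<in> \<beta>"
    unfolding \<beta>_def by (rule equiv_class_self[OF equiv_dihedral_rel]) simp
  have "\<beta> \<in> B3 d"
    using \<beta> assms(2) by (auto simp: B3_def \<beta>_def dihedral_rel_def count_list_rotate)
  then have "\<beta> \<in> B3_tilde d"
    using w assms(3) by (auto simp: B3_tilde_def contains_word_def)
  then have "T_bracelet \<beta> \<in> complex_span (T_bracelet ` B3_tilde d)"
    unfolding complex_span_def by (intro span_base imageI)
  then show ?thesis using T_bracelet_eq[OF \<beta> w] by simp
qed

lemma T3_base_in_span:
  assumes "a \<le> 1" "a + b + c + 3 = d"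
  shows "T3 a b c \<in> complex_span (T_bracelet ` B3_tilde d)"
proof -
  \<comment> \<open>The word starts with 11 or 101 respectively.\<close>
  have "a = 0 \<or> a = 1" using assms(1) by auto
  then show ?thesis
    unfolding T3_def using assms(2)
    by (intro T_word_in_span) (auto simp: Cons_prefix_Cons intro!: prefix_imp_sublist)
qed

lemma T3_in_span:
  assumes "a + b + c + 3 = d"
  shows "T3 a b c \<in> complex_span (T_bracelet ` B3_tilde d)"
  using assms
\<comment> \<open>The exchange moves a zero from the first gap to the second, keeping
  \<open>c\<close>; its four correction terms have first gap 0 or 1.\<close>
proof (induction a arbitrary: b)
  case 0
  then show ?case by (intro T3_base_in_span) auto
next
  case (Suc a)
  interpret vector_space "\<lambda>c p. Const c * p" by (rule vector_space_poly8)
  note in_span = Suc.IH[of "Suc b"] T3_base_in_span[where d = d]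
  show ?case
    unfolding T3_exchange[of a b c] complex_span_def
    using Suc.prems
    by (intro span_add span_diff in_span[unfolded complex_span_def]) auto
qed

theorem lemma4p13:
  fixes d a b c :: nat
  assumes "d \<ge> 1"
    and "1 < a" and "a \<le> b" and "b \<le> c"
    and "int a + int b + int c = int d - 3"
  shows "T_word ([1] @ replicate a 0 @ [1] @ replicate b 0 @ [1] @ replicate c 0)
           \<in> complex_span (T_bracelet ` B3_tilde d)"
  using T3_in_span[of a b c d] assms by (simp add: T3_def)

end
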